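(* Consider online facility location with predictions where every facility has opening cost $1$. For every $\eta_\infty\in(0,1]$ there exists a class of inputs (with maximum prediction error $\eta_\infty$) such that no (randomized) online algorithm is $o\!\left(\frac{\log\frac{n\eta_\infty}{\mathrm{OPT}}}{\log\log n}\right)$-competitive, even when $\eta_1=O(1)$.
   Context: Online facility location (OFL): in a metric space $(\mathcal{X},d)$ with facility set $\mathcal{F}$ and opening costs $w$, demand points $x_1,\dots,x_n$ arrive online; upon arrival of $x_i$ the algorithm may open facilities (never closed) and must irrevocably assign $x_i$ to an open facility $f_i$; the cost is the total opening cost of opened facilities plus $\sum_i d(x_i,f_i)$. $\mathrm{OPT}$ is the optimal offline cost, and $f^{o}_x$ denotes the facility of the optimal solution nearest to $x$. With predictions, each $x_i$ arrives together with a predicted facility $p(x_i)$. The maximum prediction error is $\eta_\infty=\max_i d(p(x_i),f^{o}_{x_i})$ and the total prediction error is $\eta_1=\sum_{i=1}^n d(p(x_i),f^{o}_{x_i})$. An algorithm is $c$-competitive if its expected cost is at most $c\cdot\mathrm{OPT}$ on every input. *)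

theory Defs
  imports "HOL-Probability.Probability" "HOL-Library.Landau_Symbols"
begin

record 'a ofl_space =
  points :: "'a set"
  distance :: "'a \<Rightarrow> 'a \<Rightarrow> real"
  facilities :: "'a set"
  opening_cost :: "'a \<Rightarrow> real"

definition ofl_space :: "'a ofl_space \<Rightarrow> bool" where
  "ofl_space X \<longleftrightarrow>
     Metric_space (points X) (distance X) \<and>
     facilities X \<subseteq> points X \<and> facilities X \<noteq> {} \<and>
     (\<forall>f\<in>facilities X. 0 \<le> opening_cost X f)"

definition unit_opening_costs :: "'a ofl_space \<Rightarrow> bool" where
  "unit_opening_costs X \<longleftrightarrow> (\<forall>f\<in>facilities X. opening_cost X f = 1)"

text \<open>A request is a demand point \<open>x\<close> together with its predicted facility \<open>p(x)\<close>.
  Repeated demand points are allowed, so predictions belong to positions in the sequence.\<close>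

type_synonym 'a request = "'a \<times> 'a"

type_synonym 'a ofl_input = "'a ofl_space \<times> 'a request list"

definition request_sequence :: "'a ofl_space \<Rightarrow> 'a request list \<Rightarrow> bool" where
  "request_sequence X \<sigma> \<longleftrightarrow> \<sigma> \<noteq> [] \<and> set \<sigma> \<subseteq> points X \<times> facilities X"

definition ofl_input :: "'a ofl_input \<Rightarrow> bool" where
  "ofl_input I \<longleftrightarrow> ofl_space (fst I) \<and> request_sequence (fst I) (snd I)"

definition input_size :: "'a ofl_input \<Rightarrow> nat" where
  "input_size I = length (snd I)"


text \<open>A solution is a finite set \<open>T\<close> of opened facilities and an assignment \<open>a\<close> of the
  demands (addressed by their position) to \<open>T\<close>.\<close>

definition solution :: "'a ofl_input \<Rightarrow> 'a set \<Rightarrow> (nat \<Rightarrow> 'a) \<Rightarrow> bool" where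
  "solution I T a \<longleftrightarrow>
     finite T \<and> T \<subseteq> facilities (fst I) \<and> (\<forall>i<input_size I. a i \<in> T)"

definition solution_cost :: "'a ofl_input \<Rightarrow> 'a set \<Rightarrow> (nat \<Rightarrow> 'a) \<Rightarrow> real" where
  "solution_cost I T a =
     (\<Sum>f\<in>T. opening_cost (fst I) f) +
     (\<Sum>i<input_size I. distance (fst I) (fst (snd I ! i)) (a i))"

definition OPT :: "'a ofl_input \<Rightarrow> real" where
  "OPT I = Inf {solution_cost I T a | T a. solution I T a}"

text \<open>\<open>fo i\<close> is a facility, of one and the same optimal solution \<open>T\<close>, that is nearest to
  the \<open>i\<close>-th demand. This is a relation because optimal solutions and nearest facilities
  need not be unique.\<close>

definition nearest_optimal :: "'a ofl_input \<Rightarrow> (nat \<Rightarrow> 'a) \<Rightarrow> bool" where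
  "nearest_optimal I fo \<longleftrightarrow>
     (\<exists>T a. solution I T a \<and> solution_cost I T a = OPT I \<and>
        (\<forall>i<input_size I. fo i \<in> T \<and>
           (\<forall>f\<in>T. distance (fst I) (fst (snd I ! i)) (fo i)
                   \<le> distance (fst I) (fst (snd I ! i)) f)))"

definition max_prediction_error :: "'a ofl_input \<Rightarrow> (nat \<Rightarrow> 'a) \<Rightarrow> real" where
  "max_prediction_error I fo =
     (MAX i\<in>{..<input_size I}. distance (fst I) (snd (snd I ! i)) (fo i))"

definition total_prediction_error :: "'a ofl_input \<Rightarrow> (nat \<Rightarrow> 'a) \<Rightarrow> real" where
  "total_prediction_error I fo =
     (\<Sum>i<input_size I. distance (fst I) (snd (snd I ! i)) (fo i))"


text \<open>A deterministic online algorithm maps the sequence of requests seen so far, the current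
  one included, to the facilities it opens now and the facility serving the current demand.\<close>

type_synonym 'a online_alg = "'a request list \<Rightarrow> 'a set \<times> 'a"

definition opened :: "'a online_alg \<Rightarrow> 'a request list \<Rightarrow> 'a set" where
  "opened A \<sigma> = (\<Union>i<length \<sigma>. fst (A (take (Suc i) \<sigma>)))"

definition online_algorithm :: "'a ofl_space \<Rightarrow> 'a online_alg \<Rightarrow> bool" where
  "online_algorithm X A \<longleftrightarrow>
     (\<forall>\<sigma>. request_sequence X \<sigma> \<longrightarrow>
        finite (fst (A \<sigma>)) \<and> fst (A \<sigma>) \<subseteq> facilities X \<and> snd (A \<sigma>) \<in> opened A \<sigma>)"

definition online_cost :: "'a ofl_input \<Rightarrow> 'a online_alg \<Rightarrow> real" where
  "online_cost I A =
     solution_cost I (opened A (snd I)) (\<lambda>i. snd (A (take (Suc i) (snd I))))"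

text \<open>A randomized online algorithm for a given space is a probability distribution over
  deterministic ones. The sigma algebra is arbitrary as long as all costs are random variables,
  so that any source of randomness is covered.\<close>

definition randomized_algorithm :: "'a ofl_space \<Rightarrow> 'a online_alg measure \<Rightarrow> bool" where
  "randomized_algorithm X M \<longleftrightarrow>
     prob_space M \<and> (\<forall>A\<in>space M. online_algorithm X A) \<and>
     (\<forall>\<sigma>. request_sequence X \<sigma> \<longrightarrow> online_cost (X, \<sigma>) \<in> borel_measurable M)"

text \<open>The space, including facilities and opening costs, is known to the algorithm in advance,
  hence \<open>R\<close> is indexed by it. The cost is integrated in \<open>ennreal\<close> so that an infinite
  expectation is not turned into \<open>0\<close>.\<close>

definition expected_cost ::
    "('a ofl_space \<Rightarrow> 'a online_alg measure) \<Rightarrow> 'a ofl_input \<Rightarrow> ennreal" where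
  "expected_cost R I = (\<integral>\<^sup>+A. ennreal (online_cost I A) \<partial>R (fst I))"

definition competitive_on ::
    "'a ofl_input set \<Rightarrow> ('a ofl_input \<Rightarrow> real) \<Rightarrow>
     ('a ofl_space \<Rightarrow> 'a online_alg measure) \<Rightarrow> bool" where
  "competitive_on S c R \<longleftrightarrow> (\<forall>I\<in>S. expected_cost R I \<le> ennreal (c I * OPT I))"

text \<open>The filter of \<open>n \<rightarrow> \<infinity>\<close> along the inputs of a class \<open>S\<close>.\<close>

definition large_inputs :: "'a ofl_input set \<Rightarrow> 'a ofl_input filter" where
  "large_inputs S = inf (filtercomap input_size at_top) (principal S)"

definition little_o_competitive_on ::
    "'a ofl_input set \<Rightarrow> ('a ofl_input \<Rightarrow> real) \<Rightarrow>
     ('a ofl_space \<Rightarrow> 'a online_alg measure) \<Rightarrow> bool" where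
  "little_o_competitive_on S g R \<longleftrightarrow>
     (\<exists>c. c \<in> o[large_inputs S](g) \<and> competitive_on S c R)"

definition lower_bound_rate :: "real \<Rightarrow> 'a ofl_input \<Rightarrow> real" where
  "lower_bound_rate \<eta> I =
     ln (real (input_size I) * \<eta> / OPT I) / ln (ln (real (input_size I)))"

end

theory Submission
  imports Defs "HOL-Real_Asymp.Real_Asymp"
begin

text \<open>
  The leaves of a complete binary tree of height \<open>h\<close>, numbered \<open>0, \<dots>, 2 ^ h - 1\<close>, carry an
  ultrametric in which leaves with lowest common ancestor at height \<open>k\<close> are at distance
  \<open>(2h) ^ k / (2h) ^ (h + 1)\<close>. For a hidden leaf \<open>s\<close>, the adversary walks from the root towards \<open>s\<close>;
  at height \<open>k < h\<close> it issues \<open>(2h) ^ (h - k)\<close> demands at the leftmost leaf below the current node,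
  each predicted to be its own facility, which reveals nothing beyond the current node. A phase
  costs \<open>1 / (2h)\<close> if served from \<open>s\<close>, so \<open>OPT < 2\<close> and the error of these predictions is
  bounded, but costs at least \<open>1\<close> if no facility is open below the current node. For random \<open>s\<close>,
  half of the facilities open below a node are lost in each step downwards, so every online
  algorithm pays at least \<open>h / 2\<close> in expectation, while \<open>ln n / ln (ln n) \<sim> h\<close>. One extra
  demand predicted at an additional facility, at distance \<open>\<eta>\<close> from every leaf, makes the
  maximum error exactly \<open>\<eta>\<close>.
\<close>

subsection \<open>An ultrametric from the dyadic tree\<close>

text \<open>\<open>x div 2 ^ k\<close> is the ancestor of leaf \<open>x\<close> at height
  \<open>k\<close>, so this is the height of the lowest common ancestor in the infinite binary
  tree.\<close>

definition lvl :: "nat \<Rightarrow> nat \<Rightarrow> nat" where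
  "lvl x y = (LEAST k. x div 2 ^ k = y div 2 ^ k)"

text \<open>Paths towards the root stay together once they have met. Rewriting with this equivalence
  reduces the ultrametric inequality to transitivity of equality.\<close>

lemma lvl_le_iff: "lvl x y \<le> k \<longleftrightarrow> x div 2 ^ k = y div 2 ^ k"
proof
  \<comment> \<open>Both quotients are 0 at height \<open>x + y\<close>, so some common ancestor
    exists and \<open>LEAST\<close> is attained.\<close>
  have "x div 2 ^ (x + y) = y div 2 ^ (x + y)"
  proof -
    have "x < 2 ^ (x + y)" "y < 2 ^ (x + y)"
      using less_exp[of "x + y"] by linarith+
    then show ?thesis by simp
  qed
  then have *: "x div 2 ^ lvl x y = y div 2 ^ lvl x y"
    unfolding lvl_def by (rule LeastI)
  assume "lvl x y \<le> k"
  then obtain j where "k = lvl x y + j"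
    using le_Suc_ex by metis
  then show "x div 2 ^ k = y div 2 ^ k"
    using * by (simp add: power_add div_mult2_eq)
next
  assume "x div 2 ^ k = y div 2 ^ k"
  then show "lvl x y \<le> k"
    unfolding lvl_def by (rule Least_le)
qed

lemma lvl_commute: "lvl x y = lvl y x"
  by (simp add: lvl_def eq_commute)

lemma lvl_eq_0_iff: "lvl x y = 0 \<longleftrightarrow> x = y"
  using lvl_le_iff[of x y 0] by simp

lemma lvl_triangle: "lvl x z \<le> max (lvl x y) (lvl y z)"
proof -
  have "lvl x y \<le> max (lvl x y) (lvl y z)" "lvl y z \<le> max (lvl x y) (lvl y z)"
    by simp_all
  then show ?thesis
    unfolding lvl_le_iff by simp
qed

text \<open>A monotone \<open>w\<close> preserves the bound by a maximum in
  \<open>lvl_triangle\<close>, and a maximum of nonnegative numbers is at most their sum.\<close>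

lemma Metric_space_ultrametric_lvl:
  assumes "mono w" "w 0 = (0::real)" "\<And>k. k > 0 \<Longrightarrow> w k > 0"
  shows "Metric_space P (\<lambda>x y. w (lvl x y))"
proof
  have nonneg: "w k \<ge> 0" for k
    using assms(2) assms(3)[of k] by (cases k) auto
  show "0 \<le> w (lvl x y)" for x y
    by (rule nonneg)
  show "w (lvl x y) = w (lvl y x)" for x y
    by (simp add: lvl_commute)
  show "w (lvl x y) = 0 \<longleftrightarrow> x = y" for x y
    using assms(2) assms(3)[of "lvl x y"] lvl_eq_0_iff[of x y] by (cases "lvl x y") auto
  show "w (lvl x z) \<le> w (lvl x y) + w (lvl y z)" for x y z
  proof -
    have "w (lvl x z) \<le> w (max (lvl x y) (lvl y z))"
      using assms(1) lvl_triangle by (rule monoD)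
    also have "\<dots> \<le> w (lvl x y) + w (lvl y z)"
      using nonneg[of "lvl x y"] nonneg[of "lvl y z"] by (auto simp: max_def)
    finally show ?thesis .
  qed
qed

subsection \<open>Dyadic blocks\<close>

text \<open>Toggles bit \<open>k\<close> of \<open>s\<close>, which moves \<open>s\<close> into the
  sibling of its subtree of height \<open>k\<close>.\<close>

definition flip :: "nat \<Rightarrow> nat \<Rightarrow> nat" where
  "flip k s = (if even (s div 2 ^ k) then s + 2 ^ k else s - 2 ^ k)"

lemma flip_div: "flip k s div 2 ^ k = (if even (s div 2 ^ k) then s div 2 ^ k + 1 else s div 2 ^ k - 1)"
proof (cases "even (s div 2 ^ k)")
  case True
  then show ?thesis by (simp add: flip_def)
next
  case False
  then have "s div 2 ^ k \<noteq> 0" by (metis even_zero)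
  then have "s \<ge> 2 ^ k" by (simp add: div_eq_0_iff)
  then obtain t where "s = t + 2 ^ k" by (metis le_add_diff_inverse2)
  then show ?thesis using False by (simp add: flip_def)
qed

lemma flip_flip: "flip k (flip k s) = s"
proof (cases "even (s div 2 ^ k)")
  case True
  then show ?thesis using flip_div[of k s] by (simp add: flip_def)
next
  case False
  then have "s div 2 ^ k \<noteq> 0" by (metis even_zero)
  then have "s \<ge> 2 ^ k" by (simp add: div_eq_0_iff)
  then show ?thesis using False flip_div[of k s] by (simp add: flip_def)
qed

lemma flip_div_Suc: "flip k s div 2 ^ Suc k = s div 2 ^ Suc k"
proof -
  have "flip k s div 2 ^ k div 2 = s div 2 ^ k div 2"
    unfolding flip_div by (auto elim!: evenE oddE)
  then show ?thesis
    by (simp only: power_Suc2 div_mult2_eq)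
qed

lemma less_two_power_iff_div: "(s::nat) < 2 ^ h \<longleftrightarrow> s div 2 ^ h = 0"
  by (simp add: div_eq_0_iff)

lemma flip_less:
  assumes "k < h" "s < 2 ^ h"
  shows "flip k s < 2 ^ h"
proof -
  obtain j where "h = Suc k + j"
    using assms(1) less_imp_Suc_add by auto
  then have "flip k s div 2 ^ h = s div 2 ^ h"
    by (metis flip_div_Suc power_add div_mult2_eq)
  then show ?thesis using assms(2) by (simp add: less_two_power_iff_div)
qed

lemma bij_betw_flip:
  assumes "k < h"
  shows "bij_betw (flip k) {..<2 ^ h} {..<2 ^ h}"
  by (rule bij_betw_byWitness[where f' = "flip k"])
    (auto simp: flip_flip flip_less[OF assms])

text \<open>The subtree of height \<open>k\<close> containing \<open>s\<close>. For
  \<open>k \<le> h\<close> and \<open>s < 2 ^ h\<close> all its elements are below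
  \<open>2 ^ h\<close>, so the extra facility \<open>2 ^ h\<close> lies in no such block.\<close>

definition block :: "nat \<Rightarrow> nat \<Rightarrow> nat set" where
  "block k s = {y. y div 2 ^ k = s div 2 ^ k}"

lemma block_Suc: "block (Suc k) s = block k s \<union> block k (flip k s)"
proof -
  have "y div 2 ^ k div 2 = s div 2 ^ k div 2 \<longleftrightarrow>
        y div 2 ^ k = s div 2 ^ k \<or> y div 2 ^ k = flip k s div 2 ^ k" for y
    unfolding flip_div by (cases "even (s div 2 ^ k)") (auto elim!: evenE oddE)
  then show ?thesis
    unfolding block_def power_Suc2 div_mult2_eq by blast
qed

lemma block_flip_disjoint: "block k s \<inter> block k (flip k s) = {}"
  unfolding block_def flip_div by (auto elim!: oddE)

text \<open>The halving argument: \<open>flip k\<close> exchanges the two halves of each block at height \<open>k + 1\<close>, and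
  \<open>U\<close> depends only on that block.\<close>

lemma sum_card_block:
  assumes "k < h"
    and fin: "\<And>s. s < 2 ^ h \<Longrightarrow> finite (U (s div 2 ^ Suc k))"
  shows "(\<Sum>s<2 ^ h. real (card (U (s div 2 ^ Suc k) \<inter> block k s))) =
    (\<Sum>s<2 ^ h. real (card (U (s div 2 ^ Suc k) \<inter> block (Suc k) s))) / 2"
proof -
  let ?U = "\<lambda>s. U (s div 2 ^ Suc k)"
  have "(\<Sum>s<2 ^ h. real (card (?U s \<inter> block (Suc k) s))) =
      (\<Sum>s<2 ^ h. real (card (?U s \<inter> block k s)) + real (card (?U s \<inter> block k (flip k s))))"
  proof (rule sum.cong)
    fix s :: nat assume "s \<in> {..<2 ^ h}"
    then have "finite (?U s)" using fin by blast
    then have "card ((?U s \<inter> block k s) \<union> (?U s \<inter> block k (flip k s))) =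
        card (?U s \<inter> block k s) + card (?U s \<inter> block k (flip k s))"
      using block_flip_disjoint[of k s] by (intro card_Un_disjoint) auto
    then show "real (card (?U s \<inter> block (Suc k) s)) =
        real (card (?U s \<inter> block k s)) + real (card (?U s \<inter> block k (flip k s)))"
      by (simp add: block_Suc Int_Un_distrib)
  qed simp
  also have "\<dots> = (\<Sum>s<2 ^ h. real (card (?U s \<inter> block k s))) +
      (\<Sum>s<2 ^ h. real (card (?U (flip k s) \<inter> block k (flip k s))))"
    by (simp only: sum.distrib flip_div_Suc)
  also have "(\<Sum>s<2 ^ h. real (card (?U (flip k s) \<inter> block k (flip k s)))) =
      (\<Sum>s<2 ^ h. real (card (?U s \<inter> block k s)))"
    by (rule sum.reindex_bij_betw[OF bij_betw_flip[OF assms(1)]])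
  finally show ?thesis by simp
qed

subsection \<open>Costs of online algorithms and offline solutions\<close>

definition connection_cost :: "'a ofl_space \<Rightarrow> 'a online_alg \<Rightarrow> 'a request list \<Rightarrow> real" where
  "connection_cost X A \<sigma> = (\<Sum>i<length \<sigma>. distance X (fst (\<sigma> ! i)) (snd (A (take (Suc i) \<sigma>))))"

lemma sum_list_concat: "sum_list (concat xss) = (\<Sum>xs\<leftarrow>xss. sum_list xs :: real)"
  by (induction xss) auto

lemma sum_lessThan_add: "(\<Sum>i<m + n. f i) = (\<Sum>i<m. f i) + (\<Sum>i<n. f (m + i :: nat) :: real)"
  by (induction n) auto

lemma connection_cost_append:
  "connection_cost X A (\<sigma> @ \<tau>) = connection_cost X A \<sigma> +
    (\<Sum>i<length \<tau>. distance X (fst (\<tau> ! i)) (snd (A (\<sigma> @ take (Suc i) \<tau>))))"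
  unfolding connection_cost_def length_append sum_lessThan_add
  by (simp add: nth_append)

lemma opened_append_mono: "opened A \<sigma> \<subseteq> opened A (\<sigma> @ \<tau>)"
proof
  fix f assume "f \<in> opened A \<sigma>"
  then obtain i where "i < length \<sigma>" "f \<in> fst (A (take (Suc i) \<sigma>))"
    by (auto simp: opened_def)
  then have "i < length (\<sigma> @ \<tau>)" "f \<in> fst (A (take (Suc i) (\<sigma> @ \<tau>)))"
    by simp_all
  then show "f \<in> opened A (\<sigma> @ \<tau>)"
    unfolding opened_def by blast
qed

lemma request_sequence_take:
  assumes "request_sequence X \<sigma>"
  shows "request_sequence X (take (Suc i) \<sigma>)"
  using assms set_take_subset[of "Suc i" \<sigma>] unfolding request_sequence_def by auto

lemma opened_finite:
  assumes "online_algorithm X A" "request_sequence X \<sigma>"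
  shows "finite (opened A \<sigma>)" "opened A \<sigma> \<subseteq> facilities X"
  using assms(1) request_sequence_take[OF assms(2)]
  unfolding opened_def online_algorithm_def by auto

lemma unit_cost_solution_cost:
  assumes "unit_opening_costs X" "T \<subseteq> facilities X"
  shows "solution_cost (X, \<sigma>) T a =
    real (card T) + (\<Sum>i<length \<sigma>. distance X (fst (\<sigma> ! i)) (a i))"
proof -
  have "(\<Sum>f\<in>T. opening_cost X f) = (\<Sum>f\<in>T. 1)"
    using assms unfolding unit_opening_costs_def by (intro sum.cong) auto
  then show ?thesis by (simp add: solution_cost_def input_size_def)
qed

lemma unit_cost_online_cost:
  assumes "unit_opening_costs X" "online_algorithm X A" "request_sequence X \<sigma>"
  shows "online_cost (X, \<sigma>) A = real (card (opened A \<sigma>)) + connection_cost X A \<sigma>"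
  using unit_cost_solution_cost[OF assms(1) opened_finite(2)[OF assms(2,3)]]
  by (simp add: online_cost_def connection_cost_def)

text \<open>The cost sees an assignment only at positions below the input size. Restricting
  assignments to these leaves finitely many costs, so the infimum is a minimum.\<close>

lemma OPT_attained_if_finite:
  assumes "finite (facilities (fst I))" "facilities (fst I) \<noteq> {}"
  shows "\<exists>T a. solution I T a \<and> solution_cost I T a = OPT I"
proof -
  let ?F = "facilities (fst I)" and ?n = "input_size I"
  let ?C = "{solution_cost I T a | T a. solution I T a}"
  have "?C \<subseteq> (\<lambda>(T, b). solution_cost I T b) ` (Pow ?F \<times> PiE {..<?n} (\<lambda>_. ?F))"
  proof
    fix c assume "c \<in> ?C"
    then obtain T a where *: "solution I T a" "c = solution_cost I T a" by blast
    then have "c = solution_cost I T (restrict a {..<?n})"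
      by (simp add: solution_cost_def)
    moreover have "T \<subseteq> ?F" "restrict a {..<?n} \<in> PiE {..<?n} (\<lambda>_. ?F)"
      using *(1) by (auto simp: solution_def)
    ultimately show "c \<in> (\<lambda>(T, b). solution_cost I T b) ` (Pow ?F \<times> PiE {..<?n} (\<lambda>_. ?F))"
      by (intro image_eqI[of _ _ "(T, restrict a {..<?n})"]) auto
  qed
  then have fin: "finite ?C"
    by (rule finite_subset) (use assms in \<open>auto intro!: finite_PiE\<close>)
  obtain f where "f \<in> ?F" using assms(2) by blast
  then have "solution I {f} (\<lambda>_. f)" by (simp add: solution_def)
  then have "?C \<noteq> {}" by blast
  then have "Inf ?C \<in> ?C"
    using Min_in[OF fin] cInf_eq_Min[OF fin] by simp
  then show ?thesis unfolding OPT_def by force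
qed

subsection \<open>The hard instances\<close>

text \<open>The last bound says that the diameter \<open>weight h\<close> of the leaves is at most
  \<eta>, which keeps \<open>weight\<close> monotone beyond level \<open>h\<close>. For fixed \<eta>
  it holds for all large \<open>h\<close>.\<close>

locale hard_instance =
  fixes h :: nat and \<eta> :: real
  assumes h: "h \<ge> 2" and eta: "0 < \<eta>" "\<eta> \<le> 1" "1 / (2 * real h) \<le> \<eta>"
begin

text \<open>Among the points up to \<open>2 ^ h\<close>, a level above \<open>h\<close> occurs only
  between the extra point \<open>2 ^ h\<close> and a leaf. The scaling is such that the
  \<open>(2 * h) ^ (h - k)\<close> demands of a phase cost exactly 1 in total at distance
  \<open>weight (Suc k)\<close>.\<close>

definition weight :: "nat \<Rightarrow> real" where
  "weight k = (if k = 0 then 0 else if k \<le> h then real (2 * h) ^ k / real (2 * h) ^ Suc h else \<eta>)"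

definition dst :: "nat \<Rightarrow> nat \<Rightarrow> real" where
  "dst x y = weight (lvl x y)"

definition X :: "nat ofl_space" where
  "X = \<lparr>points = {..2 ^ h}, distance = dst, facilities = {..2 ^ h}, opening_cost = (\<lambda>_. 1)\<rparr>"

definition demand :: "nat \<Rightarrow> nat \<Rightarrow> nat" where
  "demand k s = s div 2 ^ k * 2 ^ k"

definition phase :: "nat \<Rightarrow> nat \<Rightarrow> nat request list" where
  "phase k s = replicate ((2 * h) ^ (h - k)) (demand k s, demand k s)"

text \<open>The phases run downwards from \<open>h - 1\<close> to \<open>k\<close>. The leading request carries the prediction
  with error \<open>\<eta>\<close>.\<close>

definition requests :: "nat \<Rightarrow> nat \<Rightarrow> nat request list" where
  "requests k s = (0, 2 ^ h) # concat (map (\<lambda>j. phase j s) (rev [k..<h]))"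

abbreviation full :: "nat \<Rightarrow> nat request list" where
  "full s \<equiv> requests 0 s"

lemma weight_top: "weight h = 1 / (2 * real h)"
  using h by (simp add: weight_def)

lemma weight_eq: "0 < k \<Longrightarrow> k \<le> h \<Longrightarrow> weight k = real (2 * h) ^ k / real (2 * h) ^ Suc h"
  by (simp add: weight_def)

lemma weight_nonneg: "weight k \<ge> 0"
  using eta by (simp add: weight_def)

lemma weight_mono: "mono weight"
proof (rule monoI)
  fix i j :: nat assume ij: "i \<le> j"
  have le: "weight i \<le> weight j" if "i \<noteq> 0" "i \<le> j" "j \<le> h" for i j
  proof -
    have "real (2 * h) ^ i \<le> real (2 * h) ^ j"
      using h that by (intro power_increasing) auto
    then show ?thesis
      using that by (simp only: weight_eq divide_right_mono zero_le_power of_nat_0_le_iff)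
  qed
  consider "i = 0" | "i \<noteq> 0" "j \<le> h" | "i \<noteq> 0" "i \<le> h" "j > h" | "i > h" by linarith
  then show "weight i \<le> weight j"
  proof cases
    case 1
    then show ?thesis using weight_nonneg[of j] by (simp add: weight_def)
  next
    case 2
    then show ?thesis using ij by (intro le)
  next
    case 3
    then show ?thesis using le[of i h] weight_top eta(3) by (simp add: weight_def)
  next
    case 4
    then show ?thesis using ij by (simp add: weight_def)
  qed
qed

lemma ofl_space_X: "ofl_space X"
proof -
  have "Metric_space {..2 ^ h} dst"
    unfolding dst_def
    by (rule Metric_space_ultrametric_lvl[OF weight_mono]) (use h eta in \<open>auto simp: weight_def\<close>)
  then show ?thesis by (auto simp: ofl_space_def X_def)
qed

lemma unit_X: "unit_opening_costs X"
  by (simp add: unit_opening_costs_def X_def)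

lemma demand_less:
  assumes "s < 2 ^ h"
  shows "demand k s < 2 ^ h"
proof -
  have "demand k s \<le> s" unfolding demand_def by (rule div_times_less_eq_dividend)
  then show ?thesis using assms by simp
qed

lemma demand_div: "demand k s div 2 ^ k = s div 2 ^ k"
  by (simp add: demand_def)

lemma requests_step:
  "k < h \<Longrightarrow> requests k s = requests (Suc k) s @ phase k s"
  by (simp add: requests_def upt_conv_Cons)

text \<open>Phases at heights \<open>j \<ge> k\<close> use only \<open>s div 2 ^ j\<close>. Hence
  leaves of the same block at height \<open>k\<close> are indistinguishable to an online algorithm
  until the phase at height \<open>k\<close> has ended.\<close>

lemma requests_depend:
  assumes "s div 2 ^ k = t div 2 ^ k"
  shows "requests k s = requests k t"
proof -
  have "phase j s = phase j t" if kj: "k \<le> j" for j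
  proof -
    obtain i where "j = k + i" using le_Suc_ex[OF kj] by blast
    then have "s div 2 ^ j = t div 2 ^ j" using assms by (simp only: power_add div_mult2_eq)
    then show ?thesis by (simp only: phase_def demand_def)
  qed
  then have "map (\<lambda>j. phase j s) (rev [k..<h]) = map (\<lambda>j. phase j t) (rev [k..<h])"
    by (intro map_cong) auto
  then show ?thesis by (simp only: requests_def)
qed

lemma set_requests:
  "set (requests k s) \<subseteq> insert (0, 2 ^ h) (range (\<lambda>j. (demand j s, demand j s)))"
  by (auto simp: requests_def phase_def)

lemma request_sequence_requests:
  assumes "s < 2 ^ h"
  shows "request_sequence X (requests k s)"
proof -
  have "set (requests k s) \<subseteq> {..2 ^ h} \<times> {..2 ^ h}"
    using set_requests[of k s] demand_less[OF assms] less_imp_le by blast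
  then show ?thesis
    by (simp add: request_sequence_def X_def) (simp add: requests_def)
qed

subsection \<open>Lower bound on the online cost\<close>

text \<open>Opened sets only grow, so every demand of the phase is served from outside the block,
  hence at level at least \<open>Suc k\<close>.\<close>

lemma phase_cost:
  assumes A: "online_algorithm X A" and s: "s < 2 ^ h" and k: "k < h"
    and none: "opened A (requests k s) \<inter> block k s = {}"
  shows "connection_cost X A (requests k s) \<ge> connection_cost X A (requests (Suc k) s) + 1"
proof -
  let ?r = "(2 * h) ^ (h - k)" and ?\<sigma> = "requests (Suc k) s"
  have step: "dst (demand k s) (snd (A (?\<sigma> @ take (Suc i) (phase k s)))) \<ge> weight (Suc k)" for i
  proof -
    let ?\<tau> = "?\<sigma> @ take (Suc i) (phase k s)"
    have eq: "requests k s = ?\<tau> @ drop (Suc i) (phase k s)"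
      using requests_step[OF k] by simp
    have "request_sequence X ?\<tau>"
    proof -
      have "set ?\<tau> \<subseteq> set (requests k s)"
        unfolding requests_step[OF k] using set_take_subset[of "Suc i" "phase k s"] by auto
      then show ?thesis
        using request_sequence_requests[OF s, of k] request_sequence_requests[OF s, of "Suc k"]
        unfolding request_sequence_def by auto
    qed
    then have "snd (A ?\<tau>) \<in> opened A ?\<tau>"
      using A unfolding online_algorithm_def by blast
    then have "snd (A ?\<tau>) \<notin> block k s"
      using none opened_append_mono[of A ?\<tau> "drop (Suc i) (phase k s)"] eq by auto
    then have "\<not> lvl (demand k s) (snd (A ?\<tau>)) \<le> k"
      by (auto simp: lvl_le_iff block_def demand_div)
    then show ?thesis
      unfolding dst_def by (intro monoD[OF weight_mono]) simp
  qed
  have "1 = real ?r * weight (Suc k)"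
  proof -
    have "real ?r * (real (2 * h) ^ Suc k) = real (2 * h) ^ Suc h"
      using k by (simp only: of_nat_power flip: power_add) (simp del: power_Suc)
    then show ?thesis using k h by (simp add: weight_def field_simps)
  qed
  also have "\<dots> = (\<Sum>i<?r. weight (Suc k))" by simp
  also have "\<dots> \<le> (\<Sum>i<?r. dst (demand k s) (snd (A (?\<sigma> @ take (Suc i) (phase k s)))))"
    by (intro sum_mono step)
  also have "\<dots> = (\<Sum>i<length (phase k s). distance X (fst (phase k s ! i))
      (snd (A (?\<sigma> @ take (Suc i) (phase k s)))))"
    by (simp add: phase_def X_def)
  finally show ?thesis
    unfolding requests_step[OF k] connection_cost_append by simp
qed

lemma dst_nonneg: "dst x y \<ge> 0"
  by (simp add: dst_def weight_nonneg)

lemma connection_cost_nonneg: "connection_cost X A \<sigma> \<ge> 0"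
  by (simp add: connection_cost_def X_def dst_nonneg sum_nonneg)

lemma connection_cost_mono: "connection_cost X A (\<sigma> @ \<tau>) \<ge> connection_cost X A \<sigma>"
  unfolding connection_cost_append by (simp add: X_def dst_nonneg sum_nonneg)

text \<open>Let \<open>c\<close> and \<open>p\<close> count the open facilities in the block after
  and before the phase. At least \<open>c - p\<close> facilities are opened. If
  \<open>c = 0\<close>, \<open>phase_cost\<close> adds 1; if \<open>c \<ge> 1\<close>, then
  \<open>c \<ge> c / 2 + 1 / 2\<close>. Either way the cost grows by at least
  \<open>c / 2 - p + 1 / 2\<close>.\<close>

lemma phase_potential:
  assumes A: "online_algorithm X A" and s: "s < 2 ^ h" and k: "k < h"
  shows "online_cost (X, requests (Suc k) s) A + real (card (opened A (requests k s) \<inter> block k s)) / 2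
      - real (card (opened A (requests (Suc k) s) \<inter> block k s)) + 1 / 2
    \<le> online_cost (X, requests k s) A"
proof -
  let ?O = "opened A (requests k s)" and ?P = "opened A (requests (Suc k) s)" and ?B = "block k s"
  have fin: "finite ?O"
    by (rule opened_finite[OF A request_sequence_requests[OF s]])
  have sub: "?P \<subseteq> ?O"
    unfolding requests_step[OF k] by (rule opened_append_mono)
  have finP: "finite ?P" using fin sub finite_subset by blast
  \<comment> \<open>Inclusion-exclusion, to count the facilities newly opened inside the
    block.\<close>
  have "card (?O \<inter> ?B) + card ?P = card (?O \<inter> ?B \<union> ?P) + card (?P \<inter> ?B)"
  proof -
    have eq: "?O \<inter> ?B \<inter> ?P = ?P \<inter> ?B" using sub by blast
    have "finite (?O \<inter> ?B)" using fin by simp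
    from card_Un_Int[OF this finP] show ?thesis unfolding eq .
  qed
  moreover have "card (?O \<inter> ?B \<union> ?P) \<le> card ?O"
    using fin sub by (intro card_mono) auto
  ultimately have c: "real (card (?O \<inter> ?B)) + real (card ?P) \<le> real (card ?O) + real (card (?P \<inter> ?B))"
    by linarith
  have d: "connection_cost X A (requests (Suc k) s) \<le> connection_cost X A (requests k s)"
    unfolding requests_step[OF k] by (rule connection_cost_mono)
  show ?thesis
  proof (cases "?O \<inter> ?B = {}")
    case True
    with phase_cost[OF A s k True] c show ?thesis
      by (simp add: unit_cost_online_cost[OF unit_X A request_sequence_requests[OF s]])
  next
    case False
    then have "card (?O \<inter> ?B) \<ge> 1"
      using fin by (simp add: Suc_leI card_gt_0_iff)
    then have "real (card (?O \<inter> ?B)) \<ge> 1" by simp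
    with c d show ?thesis
      by (simp add: unit_cost_online_cost[OF unit_X A request_sequence_requests[OF s]])
  qed
qed

text \<open>Induction downwards from \<open>h\<close>, with half the number of open facilities in
  the current block as potential. By \<open>sum_card_block\<close> the loss \<open>p\<close> of
  \<open>phase_potential\<close> sums to exactly the potential of the previous height and cancels
  it, so each phase gains 1/2 per leaf.\<close>

lemma sum_online_cost:
  assumes A: "online_algorithm X A" and k: "k \<le> h"
  shows "(\<Sum>s<2 ^ h. online_cost (X, requests k s) A) \<ge>
    2 ^ h * (real (h - k) / 2) + (\<Sum>s<2 ^ h. real (card (opened A (requests k s) \<inter> block k s))) / 2"
  using k
proof (induction rule: inc_induct)
  case base
  have "real (card (opened A (requests h s) \<inter> block h s)) / 2 \<le> online_cost (X, requests h s) A"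
    if s: "s < 2 ^ h" for s
  proof -
    have "finite (opened A (requests h s))"
      by (rule opened_finite[OF A request_sequence_requests[OF s]])
    then have "card (opened A (requests h s) \<inter> block h s) \<le> card (opened A (requests h s))"
      by (intro card_mono) auto
    then show ?thesis
      using connection_cost_nonneg[of A "requests h s"]
      by (simp add: unit_cost_online_cost[OF unit_X A request_sequence_requests[OF s]])
  qed
  then show ?case
    unfolding sum_divide_distrib by (auto intro!: sum_mono simp del: divide_le_eq_numeral1)
next
  case (step k)
  let ?a = "\<lambda>k s. real (card (opened A (requests k s) \<inter> block k s))"
  let ?b = "\<lambda>s. real (card (opened A (requests (Suc k) s) \<inter> block k s))"
  let ?c = "\<lambda>k s. online_cost (X, requests k s) A"
  \<comment> \<open>The set opened before the phase is a function of the block at height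
    \<open>Suc k\<close> alone, the form that \<open>sum_card_block\<close> expects;
    \<open>u * 2 ^ Suc k\<close> is a representative leaf.\<close>
  define U where "U u = opened A (requests (Suc k) (u * 2 ^ Suc k))" for u
  have U: "opened A (requests (Suc k) s) = U (s div 2 ^ Suc k)" for s
    unfolding U_def by (subst requests_depend[of s "Suc k" "s div 2 ^ Suc k * 2 ^ Suc k"]) simp_all
  have "(\<Sum>s<2 ^ h. ?b s) = (\<Sum>s<2 ^ h. ?a (Suc k) s) / 2"
    unfolding U
  proof (rule sum_card_block[OF step(2)])
    fix s :: nat assume "s < 2 ^ h"
    then show "finite (U (s div 2 ^ Suc k))"
      unfolding U[symmetric] by (intro opened_finite(1)[OF A] request_sequence_requests)
  qed
  moreover have "(\<Sum>s<2 ^ h. ?c (Suc k) s + ?a k s / 2 - ?b s + 1 / 2) \<le> (\<Sum>s<2 ^ h. ?c k s)"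
    by (intro sum_mono phase_potential[OF A _ step(2)]) simp
  moreover have "real (h - k) = real (h - Suc k) + 1"
    using step(2) by (simp add: of_nat_diff)
  moreover have "(\<Sum>s<2 ^ h. ?c (Suc k) s + ?a k s / 2 - ?b s + 1 / 2) =
      (\<Sum>s<2 ^ h. ?c (Suc k) s) + (\<Sum>s<2 ^ h. ?a k s) / 2 - (\<Sum>s<2 ^ h. ?b s) + 2 ^ h * (1 / 2)"
    by (simp add: sum.distrib sum_subtractf sum_divide_distrib)
  moreover have "2 ^ h * (real (h - k) / 2) = 2 ^ h * (real (h - Suc k) / 2) + 2 ^ h * (1 / 2 :: real)"
    unfolding \<open>real (h - k) = real (h - Suc k) + 1\<close> by (simp add: field_simps)
  ultimately show ?case
    using step(3) by linarith
qed

text \<open>Yao's principle: \<open>sum_online_cost\<close> bounds the average over the leaves for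
  each deterministic algorithm. Exchanging sum and integral, some leaf has at least the average
  expected cost.\<close>

lemma expected_cost_lower_bound:
  assumes "randomized_algorithm X M"
  shows "\<exists>s<2 ^ h. (\<integral>\<^sup>+A. ennreal (online_cost (X, full s) A) \<partial>M) \<ge> ennreal (real h / 2)"
proof (rule ccontr)
  assume "\<not> ?thesis"
  then have less: "(\<integral>\<^sup>+A. ennreal (online_cost (X, full s) A) \<partial>M) < ennreal (real h / 2)"
    if "s < 2 ^ h" for s
    using that by (auto simp: not_le)
  \<comment> \<open>The negated claim makes all expectations finite; as reals they can be summed
    with strict inequalities.\<close>
  define e where "e s = enn2real (\<integral>\<^sup>+A. ennreal (online_cost (X, full s) A) \<partial>M)" for s
  have e: "(\<integral>\<^sup>+A. ennreal (online_cost (X, full s) A) \<partial>M) = ennreal (e s)" if "s < 2 ^ h" for s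
    unfolding e_def
    by (rule ennreal_enn2real[symmetric, OF order.strict_trans[OF less[OF that] ennreal_less_top]])
  interpret prob_space M
    using assms by (simp add: randomized_algorithm_def)
  have A: "online_algorithm X A" if "A \<in> space M" for A
    using assms that by (simp add: randomized_algorithm_def)
  have "ennreal (2 ^ h * (real h / 2)) = (\<integral>\<^sup>+A. ennreal (2 ^ h * (real h / 2)) \<partial>M)"
    by (simp add: emeasure_space_1)
  also have "\<dots> \<le> (\<integral>\<^sup>+A. ennreal (\<Sum>s<2 ^ h. online_cost (X, full s) A) \<partial>M)"
  proof (intro nn_integral_mono ennreal_leI)
    fix A assume "A \<in> space M"
    have "0 \<le> (\<Sum>s<2 ^ h. real (card (opened A (full s) \<inter> block 0 s))) / 2"
      by (simp add: sum_nonneg)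
    then show "2 ^ h * (real h / 2) \<le> (\<Sum>s<2 ^ h. online_cost (X, full s) A)"
      using sum_online_cost[OF A[OF \<open>A \<in> space M\<close>], of 0] by simp
  qed
  also have "\<dots> = (\<integral>\<^sup>+A. (\<Sum>s<2 ^ h. ennreal (online_cost (X, full s) A)) \<partial>M)"
  proof (intro nn_integral_cong sum_ennreal[symmetric])
    fix A and s :: nat assume "A \<in> space M" "s \<in> {..<2 ^ h}"
    then show "0 \<le> online_cost (X, full s) A"
      using connection_cost_nonneg[of A "full s"]
      by (simp add: unit_cost_online_cost[OF unit_X A request_sequence_requests])
  qed
  also have "\<dots> = (\<Sum>s<2 ^ h. \<integral>\<^sup>+A. ennreal (online_cost (X, full s) A) \<partial>M)"
    using assms request_sequence_requests
    by (intro nn_integral_sum measurable_compose[OF _ measurable_ennreal])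
      (auto simp: randomized_algorithm_def)
  also have "\<dots> = (\<Sum>s<2 ^ h. ennreal (e s))"
    by (intro sum.cong) (simp_all add: e)
  also have "\<dots> = ennreal (\<Sum>s<2 ^ h. e s)"
    by (intro sum_ennreal) (simp add: e_def)
  also have "\<dots> < ennreal (\<Sum>s<2 ^ h::nat. real h / 2)"
  proof (intro ennreal_lessI sum_strict_mono)
    show "0 < (\<Sum>s<2 ^ h::nat. real h / 2)" using h by simp
    show "e s < real h / 2" if "s \<in> {..<2 ^ h}" for s
    proof -
      have "s < 2 ^ h" using that by simp
      then have "ennreal (e s) < ennreal (real h / 2)"
        using less e by metis
      then show ?thesis
        by (rule ennreal_less_iff[THEN iffD1, rotated]) (simp add: e_def)
    qed
  qed (auto simp: lessThan_empty_iff)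
  finally show False by simp
qed

subsection \<open>Offline optimum and prediction errors\<close>

text \<open>Evaluates lengths, connection costs and prediction errors alike, each for a suitable
  \<open>g\<close>.\<close>

lemma sum_requests:
  "(\<Sum>i<length (full s). g (full s ! i)) =
    g (0, 2 ^ h) + (\<Sum>k<h. real ((2 * h) ^ (h - k)) * g (demand k s, demand k s))"
proof -
  have "(\<Sum>i<length (full s). g (full s ! i)) = sum_list (map g (full s))"
    by (simp add: sum_list_sum_nth atLeast0LessThan)
  also have "\<dots> = g (0, 2 ^ h) + sum_list (map (\<lambda>j. sum_list (map g (phase j s))) [0..<h])"
    by (simp add: requests_def map_concat sum_list_concat rev_map[symmetric] o_def)
  also have "\<dots> = g (0, 2 ^ h) + (\<Sum>j<h. sum_list (map g (phase j s)))"
    by (simp add: interv_sum_list_conv_sum_set_nat atLeast0LessThan)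
  finally show ?thesis
    by (simp add: phase_def map_replicate sum_list_replicate)
qed

lemma length_full:
  "real (length (full s)) = 1 + (\<Sum>k<h. real ((2 * h) ^ (h - k)))"
  using sum_requests[of "\<lambda>_. 1" s] by simp

text \<open>The phase at height 0 alone has this many demands. With \<open>length_full_le\<close> it
  determines \<open>ln n\<close> up to the factor \<open>(h + 1) / h\<close>.\<close>

lemma length_full_ge: "real (length (full s)) \<ge> real (2 * h) ^ h"
proof -
  have "real ((2 * h) ^ (h - 0)) \<le> (\<Sum>k<h. real ((2 * h) ^ (h - k)))"
    by (rule member_le_sum) (use h in auto)
  then show ?thesis unfolding length_full by simp
qed

lemma length_full_le: "real (length (full s)) \<le> real (2 * h) ^ Suc h"
proof -
  have "real ((2 * h) ^ (h - k)) \<le> real (2 * h) ^ h" for k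
    using h unfolding of_nat_power by (intro power_increasing) auto
  then have "(\<Sum>k<h. real ((2 * h) ^ (h - k))) \<le> (\<Sum>k<h. real (2 * h) ^ h)"
    by (intro sum_mono)
  moreover have "1 \<le> real (2 * h) ^ h"
    using h by (intro one_le_power) simp
  moreover have "real h * real (2 * h) ^ h + real h * real (2 * h) ^ h = real (2 * h) ^ Suc h"
    by simp
  moreover have "1 * real (2 * h) ^ h \<le> real h * real (2 * h) ^ h"
    using h by (intro mult_right_mono) auto
  ultimately show ?thesis unfolding length_full by (simp only: sum_constant card_lessThan)
qed

lemma dst_le: "x < 2 ^ h \<Longrightarrow> y < 2 ^ h \<Longrightarrow> dst x y \<le> weight h"
  unfolding dst_def by (intro monoD[OF weight_mono]) (simp add: lvl_le_iff)

lemma dst_top: "x < 2 ^ h \<Longrightarrow> dst x (2 ^ h) = \<eta>" "x < 2 ^ h \<Longrightarrow> dst (2 ^ h) x = \<eta>"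
proof -
  assume "x < 2 ^ h"
  then have "\<not> lvl x (2 ^ h) \<le> h" by (simp add: lvl_le_iff)
  then show "dst x (2 ^ h) = \<eta>" "dst (2 ^ h) x = \<eta>"
    by (simp_all add: dst_def weight_def lvl_commute[of "2 ^ h"])
qed

definition serve :: "nat \<Rightarrow> nat \<Rightarrow> real" where
  "serve s f = (\<Sum>i<length (full s). dst (fst (full s ! i)) f)"

text \<open>Each of the \<open>h\<close> phases and the leading request costs at most
  \<open>1 / (2 * h)\<close>, and \<open>(h + 1) / (2 * h) < 1\<close>.\<close>

lemma serve_self: "s < 2 ^ h \<Longrightarrow> serve s s < 1"
proof -
  assume s: "s < 2 ^ h"
  have "real ((2 * h) ^ (h - k)) * dst (demand k s) s \<le> 1 / (2 * real h)" if "k < h" for k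
  proof -
    have "dst (demand k s) s \<le> weight k"
      unfolding dst_def by (intro monoD[OF weight_mono]) (simp add: lvl_le_iff demand_div)
    then have "real ((2 * h) ^ (h - k)) * dst (demand k s) s \<le> real ((2 * h) ^ (h - k)) * weight k"
      by (intro mult_left_mono) auto
    also have "\<dots> \<le> 1 / (2 * real h)"
    proof (cases "k = 0")
      case True
      then show ?thesis by (simp add: weight_def)
    next
      case False
      have "real (2 * h) ^ (h - k) * real (2 * h) ^ k = real (2 * h) ^ h"
        using that by (simp only: flip: power_add) simp
      then have "real ((2 * h) ^ (h - k)) * weight k = real (2 * h) ^ h / real (2 * h) ^ Suc h"
        using that False by (simp only: of_nat_power weight_eq times_divide_eq_right less_imp_le neq0_conv)
      then show ?thesis using h by simp
    qed
    finally show ?thesis .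
  qed
  then have "(\<Sum>k<h. real ((2 * h) ^ (h - k)) * dst (demand k s) s) \<le> (\<Sum>k<h. 1 / (2 * real h))"
    by (intro sum_mono) simp
  moreover have "dst 0 s \<le> 1 / (2 * real h)"
    using dst_le[of 0 s] s weight_top by simp
  moreover have "1 / (2 * real h) + (\<Sum>k<h. 1 / (2 * real h)) < 1"
    using h by (simp add: field_simps)
  ultimately show ?thesis
    unfolding serve_def using sum_requests[of "\<lambda>r. dst (fst r) s" s] by simp
qed

lemma cost_eq:
  "T \<subseteq> {..2 ^ h} \<Longrightarrow>
    solution_cost (X, full s) T a = real (card T) + (\<Sum>i<length (full s). dst (fst (full s ! i)) (a i))"
  using unit_cost_solution_cost[OF unit_X, of T] by (simp add: X_def)

lemma solution_D:
  assumes "solution (X, full s) T a"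
  shows "finite T" "T \<noteq> {}" "T \<subseteq> {..2 ^ h}" "real (card T) \<le> solution_cost (X, full s) T a"
proof -
  show *: "T \<subseteq> {..2 ^ h}" "finite T"
    using assms by (auto simp: solution_def X_def)
  have "0 < input_size (X, full s)"
    by (simp add: input_size_def requests_def)
  then show "T \<noteq> {}"
    using assms by (auto simp: solution_def)
  show "real (card T) \<le> solution_cost (X, full s) T a"
    unfolding cost_eq[OF *(1)] by (simp add: sum_nonneg dst_nonneg)
qed

lemma solution_cost_ge_1: "solution (X, full s) T a \<Longrightarrow> 1 \<le> solution_cost (X, full s) T a"
  using solution_D[of s T a] by (simp add: Suc_leI card_gt_0_iff order_trans[of 1 "real (card T)"])

lemma OPT_attained:
  "\<exists>T a. solution (X, full s) T a \<and> solution_cost (X, full s) T a = OPT (X, full s)"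
  using OPT_attained_if_finite[of "(X, full s)"] ofl_space_X by (simp add: X_def ofl_space_def)

lemma OPT_ge_1: "1 \<le> OPT (X, full s)"
  using OPT_attained[of s] solution_cost_ge_1 by metis

lemma OPT_less_2:
  assumes "s < 2 ^ h"
  shows "OPT (X, full s) < 2"
proof -
  have "solution (X, full s) {s} (\<lambda>_. s)"
    using assms by (simp add: solution_def X_def)
  then have "OPT (X, full s) \<le> solution_cost (X, full s) {s} (\<lambda>_. s)"
    unfolding OPT_def using solution_cost_ge_1
    by (intro cInf_lower bdd_belowI[of _ 1]) auto
  also have "\<dots> = 1 + serve s s"
    using assms by (simp add: cost_eq serve_def)
  finally show ?thesis
    using serve_self[OF assms] by simp
qed

lemma fst_full_less: "s < 2 ^ h \<Longrightarrow> i < length (full s) \<Longrightarrow> fst (full s ! i) < 2 ^ h"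
  using set_requests[of 0 s] demand_less[of s] nth_mem[of i "full s"] by fastforce

text \<open>\<open>OPT < 2\<close> leaves room for one facility only and for connection cost below
  1. The extra facility is excluded because at least \<open>2 * h\<close> demands at distance \<eta>
  already cost 1.\<close>

lemma optimal_solution:
  assumes s: "s < 2 ^ h" and sol: "solution (X, full s) T a"
    and opt: "solution_cost (X, full s) T a = OPT (X, full s)"
  obtains f where "T = {f}" "f < 2 ^ h" "serve s f < 1"
proof -
  have "real (card T) < 2"
    using solution_D(4)[OF sol] OPT_less_2[OF s] opt by simp
  moreover have "card T \<noteq> 0"
    using solution_D(1,2)[OF sol] by simp
  ultimately have "card T = 1" by linarith
  then obtain f where T: "T = {f}"
    by (rule card_1_singletonE)
  have "a i = f" if "i < length (full s)" for i
    using sol that unfolding T solution_def input_size_def by simp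
  then have "(\<Sum>i<length (full s). dst (fst (full s ! i)) (a i)) = serve s f"
    unfolding serve_def by (intro sum.cong) auto
  then have serve: "serve s f < 1"
    using cost_eq[OF solution_D(3)[OF sol], of s a] opt OPT_less_2[OF s] by (simp add: T)
  have "f \<noteq> 2 ^ h"
  proof
    assume "f = 2 ^ h"
    then have "serve s f = (\<Sum>i<length (full s). \<eta>)"
      unfolding serve_def using fst_full_less[OF s] by (intro sum.cong) (auto simp: dst_top)
    moreover have "2 * real h \<le> real (length (full s))"
    proof -
      have "real (2 * h) ^ 1 \<le> real (2 * h) ^ h"
        using h by (intro power_increasing) auto
      then show ?thesis using length_full_ge[of s] by simp
    qed
    then have "2 * real h * \<eta> \<le> real (length (full s)) * \<eta>"
      using eta by (intro mult_right_mono) auto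
    moreover have "1 \<le> 2 * real h * \<eta>"
      using eta(3) h by (simp add: field_simps)
    ultimately show False
      using serve by simp
  qed
  then have "f < 2 ^ h"
    using solution_D(3)[OF sol] T by auto
  with T show thesis using serve by (rule that)
qed

lemma nearest_optimal_exists: "\<exists>fo. nearest_optimal (X, full s) fo" if s: "s < 2 ^ h"
proof -
  obtain T a where *: "solution (X, full s) T a" "solution_cost (X, full s) T a = OPT (X, full s)"
    using OPT_attained by blast
  obtain f where "T = {f}"
    using optimal_solution[OF s *] by metis
  with * have "nearest_optimal (X, full s) (\<lambda>_. f)"
    unfolding nearest_optimal_def by (intro exI[of _ T] exI[of _ a]) auto
  then show ?thesis by blast
qed

text \<open>Apart from the leading request, each prediction is the demand point itself, so its error
  equals the connection cost to the single optimal leaf. These errors sum to less than 1, and the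
  leading one is \<eta>.\<close>

lemma prediction_errors:
  assumes s: "s < 2 ^ h" and fo: "nearest_optimal (X, full s) fo"
  shows "max_prediction_error (X, full s) fo = \<eta>" "total_prediction_error (X, full s) fo \<le> 2"
proof -
  obtain T a where *: "solution (X, full s) T a" "solution_cost (X, full s) T a = OPT (X, full s)"
    and foT: "\<forall>i<input_size (X, full s). fo i \<in> T"
    using fo unfolding nearest_optimal_def by blast
  obtain f where T: "T = {f}" and f: "f < 2 ^ h" and serve: "serve s f < 1"
    by (rule optimal_solution[OF s *])
  have fo_eq: "fo i = f" if "i < length (full s)" for i
    using foT that T by (simp add: input_size_def)
  let ?e = "\<lambda>i. dst (snd (full s ! i)) f"
  have le: "?e i \<le> \<eta>" if "i < length (full s)" for i
  proof -
    have "full s ! i = (0, 2 ^ h) \<or> (\<exists>j. full s ! i = (demand j s, demand j s))"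
      using set_requests[of 0 s] nth_mem[OF that] by blast
    moreover have "dst (demand j s) f \<le> \<eta>" for j
      using dst_le[OF demand_less[OF s] f, of j] weight_top eta(3) by linarith
    ultimately show ?thesis
      using dst_top(2)[OF f] by auto
  qed
  have "max_prediction_error (X, full s) fo = (MAX i\<in>{..<length (full s)}. ?e i)"
    unfolding max_prediction_error_def input_size_def
    by (intro arg_cong[where f = Max] image_cong) (auto simp: fo_eq X_def)
  also have "\<dots> = \<eta>"
  proof (rule Max_eqI)
    have "?e 0 = \<eta>" "0 < length (full s)"
      using dst_top(2)[OF f] by (simp_all add: requests_def)
    then show "\<eta> \<in> ?e ` {..<length (full s)}" by force
  qed (use le in auto)
  finally show "max_prediction_error (X, full s) fo = \<eta>" .
  have "total_prediction_error (X, full s) fo = (\<Sum>i<length (full s). ?e i)"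
    unfolding total_prediction_error_def input_size_def
    by (intro sum.cong) (auto simp: fo_eq X_def)
  also have "\<dots> = \<eta> + (\<Sum>k<h. real ((2 * h) ^ (h - k)) * dst (demand k s) f)"
    using sum_requests[of "\<lambda>r. dst (snd r) f" s] dst_top(2)[OF f] by simp
  also have "\<dots> \<le> \<eta> + serve s f"
    using sum_requests[of "\<lambda>r. dst (fst r) f" s] dst_nonneg[of 0 f] by (simp add: serve_def)
  also have "\<dots> \<le> 2" using serve eta by simp
  finally show "total_prediction_error (X, full s) fo \<le> 2" .
qed

end

subsection \<open>Asymptotics\<close>

lemma eventually_large_inputs:
  "eventually P (large_inputs S) \<longleftrightarrow> (\<exists>N. \<forall>I\<in>S. N \<le> input_size I \<longrightarrow> P I)"
  unfolding large_inputs_def eventually_inf_principal eventually_filtercomap_at_top_linorder by blast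


text \<open>The quotient is \<open>(h + 1) * ln (2 * h)\<close> over
  \<open>ln h + ln (ln (2 * h))\<close>, which is asymptotic to \<open>h\<close>; the factor 2 is
  slack.\<close>

lemma rate_instance_le:
  "\<forall>\<^sub>F h in at_top. ln (real (2 * h) ^ Suc h) / ln (ln (real (2 * h) ^ h)) \<le> 2 * real h"
  by real_asymp

theorem theorem2:
  "\<exists>C::real. \<forall>\<eta>::real. 0 < \<eta> \<and> \<eta> \<le> 1 \<longrightarrow>
     (\<exists>S :: nat ofl_input set.
        (\<forall>I\<in>S. ofl_input I \<and> unit_opening_costs (fst I) \<and>
           (\<exists>fo. nearest_optimal I fo) \<and>
           (\<forall>fo. nearest_optimal I fo \<longrightarrow>
              max_prediction_error I fo = \<eta> \<and> total_prediction_error I fo \<le> C)) \<and>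
        filterlim (lower_bound_rate \<eta>) at_top (large_inputs S) \<and>
        (\<forall>R. (\<forall>X. ofl_space X \<and> unit_opening_costs X \<longrightarrow> randomized_algorithm X (R X)) \<longrightarrow>
           \<not> little_o_competitive_on S (lower_bound_rate \<eta>) R))"
proof (rule exI[of _ 2], intro allI impI)
  fix \<eta> :: real
  assume eta: "0 < \<eta> \<and> \<eta> \<le> 1"
  define h0 where "h0 = max 2 (nat \<lceil>1 / (2 * \<eta>)\<rceil>)"
  define inp where
    "inp h s = (hard_instance.X h \<eta>, hard_instance.requests h 0 s)" for h s
  define S where "S = {inp h s | h s. h0 \<le> h \<and> s < 2 ^ h}"
  have hard: "hard_instance h \<eta>" if "h0 \<le> h" for h
  proof
    show "2 \<le> h" using that by (simp add: h0_def)
    then have "1 / (2 * \<eta>) \<le> real h"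
      using that by (simp add: h0_def)
    then show "1 / (2 * real h) \<le> \<eta>"
      using eta \<open>2 \<le> h\<close> by (simp add: field_simps)
  qed (use eta in auto)
  have OPT: "1 \<le> OPT I" "OPT I < 2" if "I \<in> S" for I
    using that hard_instance.OPT_ge_1[OF hard] hard_instance.OPT_less_2[OF hard]
    by (auto simp: S_def inp_def)
  have "\<forall>I\<in>S. ofl_input I \<and> unit_opening_costs (fst I) \<and> (\<exists>fo. nearest_optimal I fo) \<and>
      (\<forall>fo. nearest_optimal I fo \<longrightarrow>
        max_prediction_error I fo = \<eta> \<and> total_prediction_error I fo \<le> 2)"
  proof
    fix I assume "I \<in> S"
    then obtain h s where I: "I = inp h s" and hs: "h0 \<le> h" "s < 2 ^ h"
      by (auto simp: S_def)
    interpret hard_instance h \<eta> by (rule hard[OF hs(1)])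
    show "ofl_input I \<and> unit_opening_costs (fst I) \<and> (\<exists>fo. nearest_optimal I fo) \<and>
      (\<forall>fo. nearest_optimal I fo \<longrightarrow>
        max_prediction_error I fo = \<eta> \<and> total_prediction_error I fo \<le> 2)"
      using ofl_space_X unit_X request_sequence_requests[OF hs(2)] nearest_optimal_exists[OF hs(2)]
        prediction_errors[OF hs(2)]
      by (simp add: I inp_def ofl_input_def)
  qed
  moreover have rate: "filterlim (lower_bound_rate \<eta>) at_top (large_inputs S)"
    unfolding filterlim_at_top
  proof
    fix Z :: real
    \<comment> \<open>Since \<open>OPT < 2\<close>, this function of the size alone bounds the rate
      from below.\<close>
    have "filterlim (\<lambda>n. ln (real n * \<eta> / 2) / ln (ln (real n))) at_top at_top"
      using eta by real_asymp
    then have "\<forall>\<^sub>F n in at_top. Z \<le> ln (real n * \<eta> / 2) / ln (ln (real n))"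
      by (simp add: filterlim_at_top)
    moreover have "\<forall>\<^sub>F n::nat in at_top. 0 < ln (ln (real n)) \<and> 0 < real n"
      by (intro eventually_conj; real_asymp)
    ultimately have "\<forall>\<^sub>F n in at_top. Z \<le> ln (real n * \<eta> / 2) / ln (ln (real n)) \<and>
        0 < ln (ln (real n)) \<and> 0 < real n"
      by (rule eventually_conj)
    then obtain N where N: "\<And>n. N \<le> n \<Longrightarrow> Z \<le> ln (real n * \<eta> / 2) / ln (ln (real n)) \<and>
        0 < ln (ln (real n)) \<and> 0 < real n"
      unfolding eventually_at_top_linorder by blast
    have "Z \<le> lower_bound_rate \<eta> I" if "I \<in> S" "N \<le> input_size I" for I
    proof -
      let ?n = "real (input_size I)"
      have "?n * \<eta> / 2 \<le> ?n * \<eta> / OPT I"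
        using OPT[OF that(1)] eta by (intro divide_left_mono) auto
      moreover have "0 < ?n * \<eta> / 2"
        using N[OF that(2)] eta by simp
      ultimately have "ln (?n * \<eta> / 2) / ln (ln ?n) \<le> lower_bound_rate \<eta> I"
        unfolding lower_bound_rate_def using N[OF that(2)]
        by (intro divide_right_mono) (auto intro: ln_mono)
      then show ?thesis using N[OF that(2)] by linarith
    qed
    then show "\<forall>\<^sub>F I in large_inputs S. Z \<le> lower_bound_rate \<eta> I"
      unfolding eventually_large_inputs by blast
  qed
  moreover have "\<not> little_o_competitive_on S (lower_bound_rate \<eta>) R"
    if R: "\<forall>X. ofl_space X \<and> unit_opening_costs X \<longrightarrow> randomized_algorithm X (R X)" for R
  proof
    assume "little_o_competitive_on S (lower_bound_rate \<eta>) R"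
    then obtain c where c: "c \<in> o[large_inputs S](lower_bound_rate \<eta>)" and comp: "competitive_on S c R"
      unfolding little_o_competitive_on_def by blast
    \<comment> \<open>With the rate at most \<open>2 * h\<close> and \<open>OPT < 2\<close>, the
      constant 1/16 gives \<open>c * OPT \<le> h / 4\<close>, below the required
      \<open>h / 2\<close>.\<close>
    have "\<forall>\<^sub>F I in large_inputs S. norm (c I) \<le> 1 / 16 * norm (lower_bound_rate \<eta> I)"
      by (rule landau_o.smallD[OF c]) simp
    moreover have "\<forall>\<^sub>F I in large_inputs S. 0 \<le> lower_bound_rate \<eta> I"
      using rate by (simp add: filterlim_at_top)
    ultimately have "\<forall>\<^sub>F I in large_inputs S. c I \<le> lower_bound_rate \<eta> I / 16"
      by eventually_elim auto
    then obtain N where N: "\<And>I. I \<in> S \<Longrightarrow> N \<le> input_size I \<Longrightarrow> c I \<le> lower_bound_rate \<eta> I / 16"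
      unfolding eventually_large_inputs by blast
    have "\<forall>\<^sub>F h::nat in at_top. 1 < ln (real (2 * h) ^ h)"
      by real_asymp
    moreover have "\<forall>\<^sub>F h::nat in at_top. real N \<le> real (2 * h) ^ h"
      by real_asymp
    ultimately have "\<forall>\<^sub>F h in at_top. h0 \<le> h \<and> real N \<le> real (2 * h) ^ h \<and> 1 < ln (real (2 * h) ^ h) \<and>
        ln (real (2 * h) ^ Suc h) / ln (ln (real (2 * h) ^ h)) \<le> 2 * real h"
      using rate_instance_le eventually_ge_at_top[of h0] by eventually_elim auto
    then obtain h where large: "h0 \<le> h" "real N \<le> real (2 * h) ^ h" "1 < ln (real (2 * h) ^ h)"
        "ln (real (2 * h) ^ Suc h) / ln (ln (real (2 * h) ^ h)) \<le> 2 * real h"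
      by (auto simp: eventually_at_top_linorder)
    interpret hard_instance h \<eta> by (rule hard[OF large(1)])
    have "2 \<le> h" by (rule h)
    have "randomized_algorithm X (R X)"
      using R ofl_space_X unit_X by blast
    then obtain s where s: "s < 2 ^ h"
      and cost: "ennreal (real h / 2) \<le> (\<integral>\<^sup>+A. ennreal (online_cost (X, full s) A) \<partial>R X)"
      using expected_cost_lower_bound by blast
    let ?I = "(X, full s)" and ?n = "real (length (full s))"
    have I: "?I \<in> S"
      using s large(1) by (auto simp: S_def inp_def)
    have "ennreal (real h / 2) \<le> ennreal (c ?I * OPT ?I)"
      using comp I cost unfolding competitive_on_def expected_cost_def by force
    then have lower: "real h / 2 \<le> c ?I * OPT ?I"
      \<comment> \<open>\<open>ennreal\<close> sends negative reals to 0; positivity of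
        \<open>h / 2\<close> excludes that case.\<close>
      using \<open>2 \<le> h\<close> by (subst (asm) ennreal_le_iff2) auto
    have "1 < real (2 * h) ^ h"
      using \<open>2 \<le> h\<close> by (intro one_less_power) auto
    have "c ?I \<le> lower_bound_rate \<eta> ?I / 16"
      using length_full_ge[of s] large(2) by (intro N[OF I]) (simp add: input_size_def)
    also have "lower_bound_rate \<eta> ?I \<le> ln (real (2 * h) ^ Suc h) / ln (ln (real (2 * h) ^ h))"
      unfolding lower_bound_rate_def input_size_def snd_conv
    proof (intro frac_le)
      have n: "0 < ?n" by (simp add: requests_def)
      have "?n * \<eta> / OPT ?I \<le> ?n * 1 / 1"
        using OPT[OF I] eta by (intro frac_le mult_left_mono) auto
      also have "\<dots> \<le> real (2 * h) ^ Suc h"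
        using length_full_le by simp
      finally show "ln (?n * \<eta> / OPT ?I) \<le> ln (real (2 * h) ^ Suc h)"
        using n OPT[OF I] eta by (intro ln_mono) auto
      show "ln (ln (real (2 * h) ^ h)) \<le> ln (ln ?n)"
        using large(3) length_full_ge[of s] \<open>1 < real (2 * h) ^ h\<close> by (intro ln_mono) auto
      show "0 \<le> ln (real (2 * h) ^ Suc h)"
        using \<open>2 \<le> h\<close> by (intro ln_ge_zero one_le_power) auto
      show "0 < ln (ln (real (2 * h) ^ h))"
        by (rule ln_gt_zero[OF large(3)])
    qed
    also have "\<dots> \<le> 2 * real h" by (rule large(4))
    finally have "c ?I \<le> real h / 8" by simp
    then have "c ?I * OPT ?I \<le> real h / 8 * 2"
      using OPT[OF I] by (intro mult_mono) auto
    then show False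
      using lower \<open>2 \<le> h\<close> by simp
  qed
  ultimately show "\<exists>S :: nat ofl_input set.
        (\<forall>I\<in>S. ofl_input I \<and> unit_opening_costs (fst I) \<and>
           (\<exists>fo. nearest_optimal I fo) \<and>
           (\<forall>fo. nearest_optimal I fo \<longrightarrow>
              max_prediction_error I fo = \<eta> \<and> total_prediction_error I fo \<le> 2)) \<and>
        filterlim (lower_bound_rate \<eta>) at_top (large_inputs S) \<and>
        (\<forall>R. (\<forall>X. ofl_space X \<and> unit_opening_costs X \<longrightarrow> randomized_algorithm X (R X)) \<longrightarrow>
           \<not> little_o_competitive_on S (lower_bound_rate \<eta>) R)"
    by (intro exI[of _ S]) blast
qed

end
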